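(* Let $p:\mathbb{R}\to\mathbb{R}$ be a non-smooth arbitrary support distribution, and let $\mathcal{F}_p=\{p_{l,s}(x)=\frac1s p(\frac{x-l}{s}) : l,s\in\mathbb{R},\, s>0\}$ be the location-scale family generated by $p$ (a non-smooth location-scale family with arbitrary support), with parameter $\lambda=(\lambda_1,\lambda_2)=(l,s)$. Then the curvature of the corresponding probability family manifold has value $$S=-\frac{a^2}{a^2b^2-c^2},$$ where $$a^2=\mathbb{E}_p\left[\left(\frac{p'(x)}{p(x)}\right)^2\right]\ge 0,\qquad b^2=\mathbb{E}_p\left[\left(1+x\frac{p'(x)}{p(x)}\right)^2\right]\ge 0,\qquad c=\mathbb{E}_p\left[\frac{p'(x)}{p(x)}\left(1+x\frac{p'(x)}{p(x)}\right)\right].$$ In particular, if $c=0$ (and $a\neq 0$), then $S=-\frac{a^2}{a^2b^2}=-\frac{1}{b^2}$.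
   Context: For a real-valued function $p$ on $\mathbb{R}$, its positive support is $p^+=\{x\in\mathbb{R} : p(x)>0\}$; "arbitrary support" means that $p^+\subseteq\mathbb{R}$ may be a proper subset of $\mathbb{R}$. A function $p:\mathbb{R}\to\mathbb{R}$ is a non-smooth arbitrary support distribution if: (1) $p(x)\ge 0$ for all $x$, and $p$ has arbitrary support; (2) $p^+$ is a measurable set of non-zero measure, and $p$ is Lebesgue integrable on $p^+$ with $\int_{p^+}p(x)\,dx=\int_{-\infty}^{+\infty}p(x)\,dx=1$; (3) instead of smoothness, the derivative $p'(x)$ exists and is finite almost everywhere in the Lebesgue measure. Expectations are taken over the positive support: $\mathbb{E}_q[f(x)]=\int_{q^+}q(x)f(x)\,dx$ for a density $q$. The metric tensor of the manifold of a parametric family $p_\lambda$, $\lambda=(\lambda_1,\lambda_2)$, is the one given by the Fisher information matrix, $$g_{ij}(\lambda)=\mathbb{E}_{p_\lambda}\left[-\partial_i\partial_j\log p_\lambda(x)\right],\qquad \partial_i=\frac{\partial}{\partial\lambda_i}.$$ Curvature of a metric tensor $g_{ij}$ in coordinates $x^1,\dots,x^d$ (here $d=2$; Einstein summation; $g^{ij}$ is the inverse matrix): $\Gamma^i_{jk}=\frac12 g^{il}\left(\frac{\partial g_{lj}}{\partial x^k}+\frac{\partial g_{lk}}{\partial x^j}-\frac{\partial g_{jk}}{\partial x^l}\right)$, $\Gamma^i_{jk,\lambda}=\frac{\partial\Gamma^i_{jk}}{\partial x^\lambda}$, $$S_R=g^{\mu\nu}\left(\Gamma^\lambda_{\mu\nu,\lambda}-\Gamma^\lambda_{\mu\lambda,\nu}+\Gamma^\sigma_{\mu\nu}\Gamma^\lambda_{\lambda\sigma}-\Gamma^\sigma_{\mu\lambda}\Gamma^\lambda_{\nu\sigma}\right),$$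 and the curvature is $S=\frac1d S_R=\frac12 S_R$.
   Formalization: The Fisher matrix is taken as E[∂i log p · ∂j log p]; the form E[-∂i∂j log p] is covered only if p is twice differentiable a.e. on its support and ∂i∂j passes under the integral (else exp(-x), x>0, is a counterexample). a², b² are assumed finite and a²b²≠c². *)

theory Defs
  imports "HOL-Analysis.Analysis"
begin

section \<open>Distributions with arbitrary support\<close>

definition pos_supp :: "(real \<Rightarrow> real) \<Rightarrow> real set" where
  "pos_supp p = {x. p x > 0}"

definition nonsmooth_distribution :: "(real \<Rightarrow> real) \<Rightarrow> bool" where
  "nonsmooth_distribution p \<longleftrightarrow>
     (\<forall>x. 0 \<le> p x) \<and>
     pos_supp p \<in> sets lebesgue \<and> emeasure lebesgue (pos_supp p) \<noteq> 0 \<and>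
     set_integrable lebesgue (pos_supp p) p \<and>
     (LINT x:pos_supp p|lebesgue. p x) = 1 \<and>
     integrable lebesgue p \<and> (LINT x|lebesgue. p x) = 1 \<and>
     (AE x in lebesgue. p differentiable (at x))"

definition expect :: "(real \<Rightarrow> real) \<Rightarrow> (real \<Rightarrow> real) \<Rightarrow> real" where
  "expect q f = (LINT x:pos_supp q|lebesgue. q x * f x)"

definition has_expect :: "(real \<Rightarrow> real) \<Rightarrow> (real \<Rightarrow> real) \<Rightarrow> bool" where
  "has_expect q f \<longleftrightarrow> set_integrable lebesgue (pos_supp q) (\<lambda>x. q x * f x)"

text \<open>The parameter is \<open>v = (l, s)\<close>, so \<open>v $ 1\<close> is the location and \<open>v $ 2\<close> the scale.\<close>

definition loc_scale :: "(real \<Rightarrow> real) \<Rightarrow> real^2 \<Rightarrow> real \<Rightarrow> real" where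
  "loc_scale p v x = 1 / (v $ 2) * p ((x - v $ 1) / (v $ 2))"


section \<open>Curvature of a metric tensor in coordinates\<close>

definition partial :: "'n::finite \<Rightarrow> (real^'n \<Rightarrow> real) \<Rightarrow> real^'n \<Rightarrow> real" where
  "partial i f v = deriv (\<lambda>t. f (v + t *\<^sub>R axis i 1)) 0"

definition christoffel ::
    "(real^'n \<Rightarrow> real^'n^'n) \<Rightarrow> 'n::finite \<Rightarrow> 'n \<Rightarrow> 'n \<Rightarrow> real^'n \<Rightarrow> real" where
  "christoffel g i j k v =
     1 / 2 * (\<Sum>l\<in>UNIV. matrix_inv (g v) $ i $ l *
       (partial k (\<lambda>w. g w $ l $ j) v + partial j (\<lambda>w. g w $ l $ k) v
        - partial l (\<lambda>w. g w $ j $ k) v))"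

definition scalar_curvature :: "(real^'n \<Rightarrow> real^'n^'n) \<Rightarrow> real^'n::finite \<Rightarrow> real" where
  "scalar_curvature g v =
     (\<Sum>\<mu>\<in>UNIV. \<Sum>\<nu>\<in>UNIV. matrix_inv (g v) $ \<mu> $ \<nu> *
       ((\<Sum>\<kappa>\<in>UNIV. partial \<kappa> (christoffel g \<kappa> \<mu> \<nu>) v)
        - (\<Sum>\<kappa>\<in>UNIV. partial \<nu> (christoffel g \<kappa> \<mu> \<kappa>) v)
        + (\<Sum>\<kappa>\<in>UNIV. \<Sum>\<sigma>\<in>UNIV. christoffel g \<sigma> \<mu> \<nu> v * christoffel g \<kappa> \<kappa> \<sigma> v)
        - (\<Sum>\<kappa>\<in>UNIV. \<Sum>\<sigma>\<in>UNIV. christoffel g \<sigma> \<mu> \<kappa> v * christoffel g \<kappa> \<nu> \<sigma> v)))"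

definition curvature :: "(real^'n \<Rightarrow> real^'n^'n) \<Rightarrow> real^'n::finite \<Rightarrow> real" where
  "curvature g v = scalar_curvature g v / real CARD('n)"


section \<open>The Fisher information matrix of the location-scale family\<close>

definition hessian_fisher_metric :: "(real \<Rightarrow> real) \<Rightarrow> real^2 \<Rightarrow> real^2^2" where
  "hessian_fisher_metric p v =
     (\<chi> i j. expect (loc_scale p v)
        (\<lambda>x. - partial i (partial j (\<lambda>w. ln (loc_scale p w x))) v))"

definition score_fisher_metric :: "(real \<Rightarrow> real) \<Rightarrow> real^2 \<Rightarrow> real^2^2" where
  "score_fisher_metric p v =
     (\<chi> i j. expect (loc_scale p v)
        (\<lambda>x. partial i (\<lambda>w. ln (loc_scale p w x)) v * partial j (\<lambda>w. ln (loc_scale p w x)) v))"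

text \<open>
  The two matrices need not agree when only a first derivative of \<open>p\<close> exists almost everywhere.
  For the exponential density (\<open>exp (- x)\<close> for \<open>x > 0\<close>, and \<open>0\<close> otherwise) the score form is
  \<open>1 / s^2\<close> times the identity, of curvature \<open>-1\<close>, while the Hessian form has the entries
  \<open>0\<close>, \<open>1 / s^2\<close>, \<open>1 / s^2\<close>, \<open>1 / s^2\<close>, of curvature \<open>0\<close>. The following is the usual condition
  under which they agree: the second derivatives of the normalisation integral
  may be taken under the integral sign.
\<close>

definition interchange_condition :: "(real \<Rightarrow> real) \<Rightarrow> bool" where
  "interchange_condition p \<longleftrightarrow>
     (AE x in lebesgue. x \<in> pos_supp p \<longrightarrow>
        (\<forall>\<^sub>F y in nhds x. p differentiable (at y)) \<and> deriv p differentiable (at x)) \<and>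
     (\<forall>v i j. v $ 2 > 0 \<longrightarrow>
        set_integrable lebesgue (pos_supp (loc_scale p v))
          (\<lambda>x. partial i (partial j (\<lambda>w. loc_scale p w x)) v) \<and>
        (LINT x:pos_supp (loc_scale p v)|lebesgue. partial i (partial j (\<lambda>w. loc_scale p w x)) v)
          = partial i (partial j (\<lambda>w. LINT x:pos_supp (loc_scale p w)|lebesgue. loc_scale p w x)) v)"

end

(*
  The substitution y = (x - l) / s turns the (l, s) scores of the family into -1/s times f(y) and
  1 + y f(y), where f = p' / p. Hence the Fisher metric is M / s^2 with the constant matrix
  M = (a^2, c; c, b^2), and the Christoffel symbols are constants divided by s, so that the curvature
  is a rational expression in the entries of M.
  For the Hessian form, p_v * (- d_i d_j ln p_v) = p_v * d_i ln p_v * d_j ln p_v - d_i d_j p_v, and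
  the last term integrates to d_i d_j 1 = 0 under the interchange condition.
*)

theory Submission
  imports Defs
begin

section \<open>Partial derivatives on the half plane of positive scale\<close>

lemma filterlim_line_nhds:
  fixes v e :: "'a::real_normed_vector"
  shows "filterlim (\<lambda>t::real. v + t *\<^sub>R e) (nhds v) (nhds 0)"
proof -
  have "isCont (\<lambda>t::real. v + t *\<^sub>R e) 0"
    by (intro continuous_intros)
  then show ?thesis
    using tendsto_at_iff_tendsto_nhds[of "\<lambda>t::real. v + t *\<^sub>R e" 0] by (simp add: isCont_def)
qed

text \<open>A coordinate line through \<open>v\<close> stays in any neighbourhood of
  \<open>v\<close> for small parameters. This allows formulas valid only for positive scale, or only
  near a point of differentiability, to be substituted before differentiating.\<close>

lemma partial_cong:
  assumes "\<forall>\<^sub>F w in nhds v. f w = h w"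
  shows "partial i f v = partial i h v"
  unfolding partial_def
  by (rule deriv_cong_ev)
     (use filterlim_line_nhds[of v "axis i 1"] assms in \<open>auto simp: filterlim_iff\<close>)

lemma partial_eqI:
  assumes "((\<lambda>t. f (v + t *\<^sub>R axis i 1)) has_field_derivative D) (at 0)"
  shows "partial i f v = D"
  using assms unfolding partial_def by (rule DERIV_imp_deriv)

lemma eventually_half_plane:
  fixes v :: "real^2"
  assumes "v $ 2 > 0"
  shows "\<forall>\<^sub>F w in nhds v. w $ 2 > 0"
proof -
  have "((\<lambda>w. w $ 2) \<longlongrightarrow> v $ 2) (nhds v)"
    by (intro tendsto_vec_nth filterlim_ident)
  then show ?thesis
    using assms by (rule order_tendstoD(1))
qed

lemma partial_const_on_half_plane:
  fixes v :: "real^2"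
  assumes "v $ 2 > 0" and "\<And>w. w $ 2 > 0 \<Longrightarrow> f w = k"
  shows "partial i f v = 0"
proof -
  have "partial i f v = partial i (\<lambda>_. k) v"
    by (rule partial_cong) (use eventually_half_plane[OF assms(1)] assms(2) in \<open>auto elim: eventually_mono\<close>)
  also have "\<dots> = 0"
    by (rule partial_eqI) simp
  finally show ?thesis .
qed

text \<open>Used with \<open>n = 2\<close> for the metric entries and with \<open>n = 1\<close> for
  the Christoffel symbols.\<close>

lemma partial_power_scale:
  fixes v :: "real^2" and f :: "real^2 \<Rightarrow> real"
  assumes v: "v $ 2 > 0" and f: "\<And>w. w $ 2 > 0 \<Longrightarrow> f w = m / (w $ 2) ^ n"
  shows "partial i f v = (if i = 2 then - real n * m / (v $ 2) ^ Suc n else 0)"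
proof -
  have "partial i f v = partial i (\<lambda>w. m / (w $ 2) ^ n) v"
    by (rule partial_cong) (use eventually_half_plane[OF v] f in \<open>auto elim: eventually_mono\<close>)
  also have "\<dots> = (if i = 2 then - real n * m / (v $ 2) ^ Suc n else 0)"
  proof (rule partial_eqI)
    \<comment> \<open>The power rule produces the exponent \<open>n - 1\<close>, truncated when
      \<open>n = 0\<close>; in that case the factor \<open>real n\<close> makes both sides
      zero.\<close>
    have *: "real n * (v $ 2 * v $ 2 ^ (n - Suc 0)) = real n * v $ 2 ^ n"
      by (cases n) auto
    show "((\<lambda>t. m / ((v + t *\<^sub>R axis i 1) $ 2) ^ n) has_field_derivative
      (if i = 2 then - real n * m / (v $ 2) ^ Suc n else 0)) (at 0)"
      using v * by (auto intro!: derivative_eq_intros simp: axis_def field_simps)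
  qed
  finally show ?thesis .
qed

section \<open>Curvature of a constant matrix divided by the squared scale\<close>

lemma matrix_inv_eqI:
  fixes A :: "'a::semiring_1^'n^'m"
  assumes "A ** B = mat 1" "B ** A = mat 1"
  shows "matrix_inv A = B"
proof -
  \<comment> \<open>\<open>matrix_inv\<close> is a choice; \<open>B\<close> witnesses that the
    choice succeeds, and two-sided inverses are unique.\<close>
  have "A ** matrix_inv A = mat 1 \<and> matrix_inv A ** A = mat 1"
    unfolding matrix_inv_def by (rule someI[of _ B]) (use assms in auto)
  then show ?thesis
    by (metis assms(2) matrix_mul_assoc matrix_mul_lid matrix_mul_rid)
qed

text \<open>The inverse metric scales as s^2, the Christoffel symbols as 1/s, and their derivatives
  and products as 1/s^2. All powers of s therefore cancel in the contraction, which leaves an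
  identity between constants.\<close>

lemma curvature_scaled_constant_metric:
  fixes g :: "real^2 \<Rightarrow> real^2^2" and m11 m12 m22 :: real
  assumes v: "v $ 2 > 0"
    and det: "m11 * m22 - m12\<^sup>2 \<noteq> 0"
    and g11: "\<And>w. w $ 2 > 0 \<Longrightarrow> g w $ 1 $ 1 = m11 / (w $ 2)\<^sup>2"
    and g12: "\<And>w. w $ 2 > 0 \<Longrightarrow> g w $ 1 $ 2 = m12 / (w $ 2)\<^sup>2"
    and g21: "\<And>w. w $ 2 > 0 \<Longrightarrow> g w $ 2 $ 1 = m12 / (w $ 2)\<^sup>2"
    and g22: "\<And>w. w $ 2 > 0 \<Longrightarrow> g w $ 2 $ 2 = m22 / (w $ 2)\<^sup>2"
  shows "curvature g v = - (m11 / (m11 * m22 - m12\<^sup>2))"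
proof -
  define D where "D = m11 * m22 - m12\<^sup>2"
  have D: "D \<noteq> 0" and DE: "m12 * m12 = m11 * m22 - D"
    using det by (auto simp: D_def power2_eq_square)
  define M :: "2 \<Rightarrow> 2 \<Rightarrow> real"
    where "M i j = (if i = 1 then (if j = 1 then m11 else m12) else (if j = 1 then m12 else m22))" for i j
  \<comment> \<open>The adjugate of \<open>M\<close> over its determinant \<open>D\<close>.\<close>
  define N :: "2 \<Rightarrow> 2 \<Rightarrow> real"
    where "N i j = (if i = 1 then (if j = 1 then m22 else - m12) else (if j = 1 then - m12 else m11)) / D" for i j
  have g: "g w $ i $ j = M i j / (w $ 2)\<^sup>2" if "w $ 2 > 0" for w i j
    using exhaust_2[of i] exhaust_2[of j] that by (auto simp: M_def g11 g12 g21 g22)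
  have inv: "matrix_inv (g w) $ i $ j = (w $ 2)\<^sup>2 * N i j" if w: "w $ 2 > 0" for w i j
  proof -
    have "matrix_inv (g w) = (\<chi> i j. (w $ 2)\<^sup>2 * N i j)"
      by (rule matrix_inv_eqI)
         (use D w in \<open>auto simp: vec_eq_iff forall_2 matrix_matrix_mult_def sum_2 mat_def g M_def N_def
            field_simps DE power2_eq_square\<close>)
    then show ?thesis by simp
  qed
  \<comment> \<open>The coefficient of 1/s^3 in the derivative of m/s^2 in direction
    \<open>k\<close>; the location direction contributes nothing.\<close>
  define d :: "2 \<Rightarrow> real \<Rightarrow> real" where "d k m = (if k = 2 then - 2 * m else 0)" for k m
  have dg: "partial k (\<lambda>w. g w $ i $ j) w = d k (M i j) / (w $ 2) ^ 3" if "w $ 2 > 0" for w i j k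
    using partial_power_scale[where f = "\<lambda>w. g w $ i $ j" and m = "M i j" and n = 2 and v = w and i = k] g that
    by (simp add: d_def numeral_eq_Suc)
  \<comment> \<open>The Christoffel symbols without their factor 1/s, which arises as s^2 times
    1/s^3.\<close>
  define K where "K i j k = (1 / 2) * (\<Sum>l\<in>UNIV. N i l * (d k (M l j) + d j (M l k) - d l (M j k)))" for i j k
  have chr: "christoffel g i j k w = K i j k / w $ 2" if w: "w $ 2 > 0" for w i j k
    using w unfolding christoffel_def K_def dg[OF w] inv[OF w] sum_2
    by (simp add: field_simps power2_eq_square power3_eq_cube)
  have dchr: "partial l (christoffel g i j k) v = (if l = 2 then - K i j k / (v $ 2)\<^sup>2 else 0)" for i j k l
    using partial_power_scale[where f = "christoffel g i j k" and m = "K i j k" and n = 1 and i = l, OF v] chr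
    by (simp add: power2_eq_square)
  \<comment> \<open>With \<open>r\<close> for the reciprocal determinant and the single relation
    \<open>r\<close>, the remaining identities are polynomial and within reach of
    \<open>algebra\<close>.\<close>
  define r where "r = 1 / D"
  have r: "r * (m11 * m22 - m12 * m12) = 1"
    using D by (simp add: r_def D_def power2_eq_square)
  have N: "N 1 1 = m22 * r" "N 1 2 = - m12 * r" "N 2 1 = - m12 * r" "N 2 2 = m11 * r"
    by (simp_all add: N_def r_def)
  have K: "K 1 1 1 = - m11 * m12 * r" "K 1 1 2 = - m11 * m22 * r" "K 1 2 1 = - m11 * m22 * r"
     "K 1 2 2 = - m12 * m22 * r" "K 2 1 1 = m11\<^sup>2 * r" "K 2 1 2 = m11 * m12 * r"
     "K 2 2 1 = m11 * m12 * r" "K 2 2 2 = - 2 + m11 * m22 * r"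
    unfolding K_def sum_2 N d_def M_def using r by (simp_all, algebra+)
  \<comment> \<open>Only derivatives in the scale direction survive: the divergence term keeps the
    index 2 alone, and the second term is present only for \<open>\<nu> = 2\<close>, where two minus
    signs cancel.\<close>
  have "scalar_curvature g v = (\<Sum>\<mu>\<in>UNIV. \<Sum>\<nu>\<in>UNIV. N \<mu> \<nu> *
       (- K 2 \<mu> \<nu> + (\<Sum>\<kappa>\<in>UNIV. if \<nu> = 2 then K \<kappa> \<mu> \<kappa> else 0)
        + (\<Sum>\<kappa>\<in>UNIV. \<Sum>\<sigma>\<in>UNIV. K \<sigma> \<mu> \<nu> * K \<kappa> \<kappa> \<sigma>)
        - (\<Sum>\<kappa>\<in>UNIV. \<Sum>\<sigma>\<in>UNIV. K \<sigma> \<mu> \<kappa> * K \<kappa> \<nu> \<sigma>)))"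
    unfolding scalar_curvature_def dchr chr[OF v] inv[OF v] sum_2
    using v by (simp add: field_simps power2_eq_square)
  also have "\<dots> = - 2 * m11 * r"
    unfolding sum_2 using r by (simp add: K N, algebra)
  finally have "scalar_curvature g v = - 2 * m11 / D"
    by (simp add: r_def)
  then show ?thesis
    by (simp add: curvature_def flip: D_def)
qed

section \<open>The substitution y = (x - l) / s for null sets and integrals\<close>

lemma AE_lebesgue_real_affine:
  fixes P :: "real \<Rightarrow> bool"
  assumes "AE x in lebesgue. P x" and c: "c \<noteq> 0"
  shows "AE x in lebesgue. P (t + c * x)"
proof -
  define f where "f y = (y - t) / c" for y
  have "negligible {x. \<not> P x}"
    using assms(1) by (simp add: completion.AE_iff_null_sets negligible_iff_null_sets)
  \<comment> \<open>The exceptional set pulled back along the affine map is its image under the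
    inverse map \<open>f\<close>, and differentiable maps of the line preserve null sets.\<close>
  then have "negligible (f ` {x. \<not> P x})"
    by (rule negligible_differentiable_image_negligible[rotated])
       (use c in \<open>auto simp: f_def[abs_def] differentiable_on_def intro!: derivative_intros\<close>)
  moreover have "f ` {x. \<not> P x} = {x. \<not> P (t + c * x)}"
    using c by (auto simp: f_def image_iff intro!: exI[of _ "t + c * _"])
  ultimately show ?thesis
    by (simp add: completion.AE_iff_null_sets negligible_iff_null_sets)
qed

text \<open>Completeness of Lebesgue measure supplies the measurability of \<open>g\<close>. This
  matters for integrands made of partial derivatives, which are known only almost
  everywhere.\<close>

lemma has_bochner_integral_lebesgue_cong_AE:
  fixes f g :: "'a::euclidean_space \<Rightarrow> 'b::euclidean_space"
  assumes "has_bochner_integral lebesgue f i" and "AE x in lebesgue. f x = g x"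
  shows "has_bochner_integral lebesgue g i"
proof -
  have f: "f \<in> borel_measurable lebesgue"
    using assms(1) by (rule borel_measurable_has_bochner_integral)
  show ?thesis
    using has_bochner_integral_cong_AE[OF f borel_measurable_AE[OF f assms(2)] assms(2)] assms(1)
    by simp
qed

lemma pos_supp_loc_scale_iff:
  "v $ 2 > 0 \<Longrightarrow> x \<in> pos_supp (loc_scale p v) \<longleftrightarrow> (x - v $ 1) / v $ 2 \<in> pos_supp p"
  by (simp add: pos_supp_def loc_scale_def zero_less_divide_iff)

text \<open>The prefactor 1/s of the density cancels the Jacobian s. \<open>F\<close> has to match
  \<open>f\<close> only almost everywhere on the support, since scores are computed only where
  \<open>p\<close> is differentiable. Integrability is part of the conclusion because the Hessian
  case subtracts two integrals.\<close>

lemma has_bochner_integral_loc_scale: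
  assumes f: "has_expect p f" and v: "v $ 2 > 0"
    and F: "AE x in lebesgue. (x - v $ 1) / v $ 2 \<in> pos_supp p \<longrightarrow> F x = f ((x - v $ 1) / v $ 2)"
  shows "has_bochner_integral lebesgue
    (\<lambda>x. indicator (pos_supp (loc_scale p v)) x *\<^sub>R (loc_scale p v x * F x)) (expect p f)"
proof -
  let ?h = "\<lambda>x. indicator (pos_supp p) x *\<^sub>R (p x * f x)"
  have "has_bochner_integral lebesgue ?h (expect p f)"
    using f by (simp add: has_bochner_integral_iff has_expect_def set_integrable_def expect_def
        set_lebesgue_integral_def)
  then have "has_bochner_integral lebesgue (\<lambda>x. ?h (- v $ 1 / v $ 2 + 1 / v $ 2 * x)) (expect p f /\<^sub>R \<bar>1 / v $ 2\<bar>)"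
    using v by (subst (asm) has_bochner_integral_lebesgue_real_affine_iff[of "1 / v $ 2" _ _ "- v $ 1 / v $ 2"]) auto
  then have "has_bochner_integral lebesgue (\<lambda>x. 1 / v $ 2 * ?h (- v $ 1 / v $ 2 + 1 / v $ 2 * x))
      (1 / v $ 2 * (expect p f /\<^sub>R \<bar>1 / v $ 2\<bar>))"
    by (intro has_bochner_integral_mult_right) simp
  moreover have "1 / v $ 2 * (expect p f /\<^sub>R \<bar>1 / v $ 2\<bar>) = expect p f"
    using v by simp
  moreover have "- v $ 1 / v $ 2 + 1 / v $ 2 * x = (x - v $ 1) / v $ 2" for x
    by (simp add: diff_divide_distrib)
  ultimately have "has_bochner_integral lebesgue (\<lambda>x. 1 / v $ 2 * ?h ((x - v $ 1) / v $ 2)) (expect p f)"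
    by simp
  then show ?thesis
    by (rule has_bochner_integral_lebesgue_cong_AE)
       (use F in \<open>eventually_elim, auto simp: indicator_def pos_supp_loc_scale_iff[OF v] loc_scale_def\<close>)
qed

lemma expect_loc_scale:
  assumes "has_expect p f" and "v $ 2 > 0"
    and "AE x in lebesgue. (x - v $ 1) / v $ 2 \<in> pos_supp p \<longrightarrow> F x = f ((x - v $ 1) / v $ 2)"
  shows "expect (loc_scale p v) F = expect p f"
  using has_bochner_integral_loc_scale[OF assms]
  by (simp add: has_bochner_integral_iff expect_def set_lebesgue_integral_def)

lemma AE_loc_scale:
  fixes v :: "real^2"
  assumes "AE y in lebesgue. P y" and "v $ 2 > 0"
  shows "AE x in lebesgue. P ((x - v $ 1) / v $ 2)"
  using AE_lebesgue_real_affine[OF assms(1), of "1 / v $ 2" "- v $ 1 / v $ 2"] assms(2)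
  by (simp add: diff_divide_distrib)

section \<open>First and second parameter derivatives of the density and its logarithm\<close>

text \<open>The score in the standardised variable \<open>y = (x - l) / s\<close>, with the factor \<open>1 / s\<close> left out.\<close>

definition score :: "(real \<Rightarrow> real) \<Rightarrow> 2 \<Rightarrow> real \<Rightarrow> real" where
  "score p i y = (if i = 1 then - (deriv p y / p y) else - (1 + y * (deriv p y / p y)))"

text \<open>The chain and product rules give the derivative in terms of \<open>deriv p\<close>;
  positivity of \<open>p\<close> at the standardised point allows it to be rewritten as density
  times score.\<close>

lemma DERIV_loc_scale:
  fixes v :: "real^2"
  assumes v: "v $ 2 > 0" and p: "p differentiable at ((x - v $ 1) / v $ 2)"
    and pos: "(x - v $ 1) / v $ 2 \<in> pos_supp p"
  shows "((\<lambda>t. loc_scale p (v + t *\<^sub>R axis i 1) x) has_field_derivative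
    loc_scale p v x * score p i ((x - v $ 1) / v $ 2) / v $ 2) (at 0)"
proof -
  let ?y = "\<lambda>t. (x - (v + t *\<^sub>R axis i 1) $ 1) / (v + t *\<^sub>R axis i 1) $ 2"
  have y: "(?y has_field_derivative (if i = 1 then - 1 / v $ 2 else - (x - v $ 1) / (v $ 2)\<^sup>2)) (at 0)"
    using v exhaust_2[of i]
    by (auto intro!: derivative_eq_intros simp: axis_def field_simps power2_eq_square)
  have "(p has_field_derivative deriv p (?y 0)) (at (?y 0))"
    using p by (simp add: DERIV_deriv_iff_real_differentiable)
  from DERIV_chain2[OF this y]
  have *: "((\<lambda>t. p (?y t)) has_field_derivative
     deriv p (?y 0) * (if i = 1 then - 1 / v $ 2 else - (x - v $ 1) / (v $ 2)\<^sup>2)) (at 0)" .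
  have "((\<lambda>t. 1 / (v + t *\<^sub>R axis i 1) $ 2) has_field_derivative (if i = 1 then 0 else - 1 / (v $ 2)\<^sup>2)) (at 0)"
    using v exhaust_2[of i]
    by (auto intro!: derivative_eq_intros simp: axis_def field_simps power2_eq_square)
  from DERIV_mult[OF this *] show ?thesis
    unfolding loc_scale_def
    by (rule DERIV_cong)
      (use v pos exhaust_2[of i] in \<open>auto simp: score_def pos_supp_def field_simps power2_eq_square\<close>)
qed

lemma partial_loc_scale:
  fixes v :: "real^2"
  assumes "v $ 2 > 0" "p differentiable at ((x - v $ 1) / v $ 2)" "(x - v $ 1) / v $ 2 \<in> pos_supp p"
  shows "partial i (\<lambda>w. loc_scale p w x) v = loc_scale p v x * score p i ((x - v $ 1) / v $ 2) / v $ 2"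
  by (rule partial_eqI, rule DERIV_loc_scale[OF assms])

lemma partial_ln_loc_scale:
  fixes v :: "real^2"
  assumes v: "v $ 2 > 0" and p: "p differentiable at ((x - v $ 1) / v $ 2)"
    and pos: "(x - v $ 1) / v $ 2 \<in> pos_supp p"
  shows "partial i (\<lambda>w. ln (loc_scale p w x)) v = score p i ((x - v $ 1) / v $ 2) / v $ 2"
proof (rule partial_eqI)
  have "loc_scale p v x > 0"
    using pos v by (simp add: pos_supp_def loc_scale_def)
  then show "((\<lambda>t. ln (loc_scale p (v + t *\<^sub>R axis i 1) x)) has_field_derivative
      score p i ((x - v $ 1) / v $ 2) / v $ 2) (at 0)"
    by (auto intro!: derivative_eq_intros DERIV_loc_scale[OF assms])
qed

text \<open>Let F be the density and G its logarithmic derivative in direction \<open>j\<close>.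
  Near \<open>v\<close> the derivative of F in direction \<open>j\<close> is F * G, and
  differentiating this product in direction \<open>i\<close> gives the identity. Differentiability
  of \<open>p\<close> is required in a neighbourhood because the inner derivative must be known
  around \<open>v\<close>.\<close>

lemma partial_partial_ln_loc_scale:
  fixes v :: "real^2"
  defines "y \<equiv> \<lambda>w :: real^2. \<lambda>x. (x - w $ 1) / w $ 2"
  assumes v: "v $ 2 > 0" and p: "\<forall>\<^sub>F z in nhds (y v x). p differentiable at z"
    and p': "deriv p differentiable at (y v x)" and pos: "y v x \<in> pos_supp p"
  shows "loc_scale p v x * - partial i (partial j (\<lambda>w. ln (loc_scale p w x))) v =
    loc_scale p v x * (score p i (y v x) / v $ 2 * (score p j (y v x) / v $ 2))
    - partial i (partial j (\<lambda>w. loc_scale p w x)) v"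
proof -
  let ?F = "\<lambda>w. loc_scale p w x" and ?G = "\<lambda>w. score p j (y w x) / w $ 2"
  have py: "p differentiable at (y v x)"
    using p by (rule eventually_nhds_x_imp_x)
  have ppos: "p (y v x) > 0"
    using pos by (simp add: pos_supp_def)
  \<comment> \<open>Conditions holding near the standardised point are carried back to parameters
    near \<open>v\<close> along this limit.\<close>
  have ytends: "((\<lambda>w. y w x) \<longlongrightarrow> y v x) (nhds v)"
    unfolding y_def using v by (intro tendsto_intros tendsto_vec_nth filterlim_ident) auto
  have "(p \<longlongrightarrow> p (y v x)) (nhds (y v x))"
    using differentiable_imp_continuous_within[OF py] 
    by (simp add: continuous_at tendsto_at_iff_tendsto_nhds)
  then have "\<forall>\<^sub>F z in nhds (y v x). p z > 0"
    using ppos by (rule order_tendstoD(1))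
  then have "\<forall>\<^sub>F z in nhds (y v x). p differentiable at z \<and> z \<in> pos_supp p"
    using p by eventually_elim (simp add: pos_supp_def)
  then have "\<forall>\<^sub>F w in nhds v. p differentiable at (y w x) \<and> y w x \<in> pos_supp p"
    by (rule eventually_compose_filterlim[OF _ ytends])
  then have ev: "\<forall>\<^sub>F w in nhds v. w $ 2 > 0 \<and> p differentiable at (y w x) \<and> y w x \<in> pos_supp p"
    using eventually_half_plane[OF v] by eventually_elim simp
  have ln: "partial i (partial j (\<lambda>w. ln (?F w))) v = partial i ?G v"
    by (rule partial_cong, rule eventually_mono[OF ev]) (simp add: partial_ln_loc_scale y_def)
  have F: "partial i (partial j ?F) v = partial i (\<lambda>w. ?F w * ?G w) v"
    by (rule partial_cong, rule eventually_mono[OF ev]) (simp add: partial_loc_scale y_def)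
  define l where "l = (\<lambda>t. v + t *\<^sub>R axis i 1)"
  have l0: "l 0 = v" by (simp add: l_def)
  have dF: "((\<lambda>t. ?F (l t)) has_field_derivative ?F v * score p i (y v x) / v $ 2) (at 0)"
    using DERIV_loc_scale[OF v] py pos by (simp add: l_def y_def)
  \<comment> \<open>Only existence matters here: \<open>D\<close> enters both second derivatives and
    cancels.\<close>
  obtain D where dG: "((\<lambda>t. ?G (l t)) has_field_derivative D) (at 0)"
  proof -
    have dy: "(\<lambda>t. y (l t) x) differentiable at 0"
      unfolding y_def l_def using v by (auto intro!: derivative_intros)
    have "(\<lambda>t. p (y (l t) x)) differentiable at 0" "(\<lambda>t. deriv p (y (l t) x)) differentiable at 0"
      using differentiable_chain_at[OF dy, of p] differentiable_chain_at[OF dy, of "deriv p"] py p'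
      by (simp_all add: l0 o_def)
    then have "(\<lambda>t. ?G (l t)) differentiable at 0"
      using ppos v dy unfolding score_def
      by (cases "j = 1") (auto intro!: derivative_intros simp: l0, auto simp: l_def intro!: derivative_intros)
    then show ?thesis
      using that real_differentiable_def by blast
  qed
  have "partial i ?G v = D"
    using dG by (intro partial_eqI) (simp add: l_def)
  moreover have "partial i (\<lambda>w. ?F w * ?G w) v = ?F v * score p i (y v x) / v $ 2 * ?G v + D * ?F v"
    using DERIV_mult[OF dF dG] by (intro partial_eqI) (simp add: l_def)
  ultimately show ?thesis
    unfolding ln F by (simp add: algebra_simps)
qed

section \<open>Integrability of the score products and the entries of both Fisher metrics\<close>

text \<open>Only the measurability of \<open>f\<close> is at stake: it is recovered from the two squares, since
  \<open>(1 + y * f y)\<^sup>2 = 1 + 2 * y * f y + y\<^sup>2 * (f y)\<^sup>2\<close>.\<close>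

lemma has_expect_mult_of_squares:
  assumes p: "integrable lebesgue p" "pos_supp p \<in> sets lebesgue"
    and f: "has_expect p (\<lambda>y. (f y)\<^sup>2)" and g: "has_expect p (\<lambda>y. (1 + y * f y)\<^sup>2)"
  shows "has_expect p (\<lambda>y. f y * (1 + y * f y))"
proof -
  define I where "I = (indicat_real (pos_supp p))"
  define A where "A y = I y * (p y * (f y)\<^sup>2)" for y
  define B where "B y = I y * (p y * (1 + y * f y)\<^sup>2)" for y
  define C where "C y = I y * (p y * (f y * (1 + y * f y)))" for y
  have int: "integrable lebesgue A" "integrable lebesgue B"
    using f g by (simp_all add: has_expect_def set_integrable_def A_def[abs_def] B_def[abs_def] I_def)
  have [measurable]: "p \<in> borel_measurable lebesgue" "I \<in> borel_measurable lebesgue"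
    "A \<in> borel_measurable lebesgue" "B \<in> borel_measurable lebesgue" "(\<lambda>y::real. y) \<in> borel_measurable lebesgue"
    using p int by (auto simp: I_def intro: measurable_completion)
  \<comment> \<open>The quotient recovers I * p * f from the expanded square, and y * A adds the
    remaining term of \<open>C\<close>. Division by y fails only at 0, a null set.\<close>
  have "(\<lambda>y. (B y - I y * p y - y\<^sup>2 * A y) / (2 * y) + y * A y) \<in> borel_measurable lebesgue"
    by measurable
  moreover have "AE y in lebesgue. (B y - I y * p y - y\<^sup>2 * A y) / (2 * y) + y * A y = C y"
    using AE_completion[OF AE_lborel_singleton[of "0::real"]]
    by eventually_elim (simp add: A_def B_def C_def field_simps power2_eq_square)
  ultimately have C: "C \<in> borel_measurable lebesgue"
    by (rule borel_measurable_AE)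
  have "integrable lebesgue C"
  proof (rule Bochner_Integration.integrable_bound)
    show "integrable lebesgue (\<lambda>y. A y + B y)"
      using int by simp
    have "norm (C y) \<le> norm (A y + B y)" for y
    proof -
      have "\<bar>a * b\<bar> \<le> a\<^sup>2 + b\<^sup>2" for a b :: real
        using sum_squares_bound[of "\<bar>a\<bar>" "\<bar>b\<bar>"] abs_ge_zero[of "a * b"]
        unfolding abs_mult power2_abs by linarith
      then have "I y * p y * \<bar>f y * (1 + y * f y)\<bar> \<le> I y * p y * ((f y)\<^sup>2 + (1 + y * f y)\<^sup>2)"
        and "0 \<le> I y * p y"
        by (auto simp: I_def pos_supp_def indicator_def intro!: mult_left_mono)
      moreover have "C y = (I y * p y) * (f y * (1 + y * f y))"
        and "A y + B y = (I y * p y) * ((f y)\<^sup>2 + (1 + y * f y)\<^sup>2)"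
        by (simp_all add: A_def B_def C_def distrib_left mult.assoc)
      ultimately show ?thesis
        by (simp add: abs_mult[of "I y * p y"])
    qed
    then show "AE y in lebesgue. norm (C y) \<le> norm (A y + B y)"
      by simp
  qed (rule C)
  then show ?thesis
    by (simp add: has_expect_def set_integrable_def C_def[abs_def] I_def)
qed

lemma score_fisher_metric_nth:
  assumes diff: "AE y in lebesgue. p differentiable at y" and v: "v $ 2 > 0"
    and int: "has_expect p (\<lambda>y. score p i y * score p j y)"
  shows "score_fisher_metric p v $ i $ j = expect p (\<lambda>y. score p i y * score p j y) / (v $ 2)\<^sup>2"
proof -
  let ?f = "\<lambda>y. score p i y / v $ 2 * (score p j y / v $ 2)"
  have f: "has_expect p ?f" "expect p ?f = expect p (\<lambda>y. score p i y * score p j y) / (v $ 2)\<^sup>2"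
    using int v by (simp_all add: has_expect_def expect_def power2_eq_square)
  have "AE x in lebesgue. (x - v $ 1) / v $ 2 \<in> pos_supp p \<longrightarrow>
    partial i (\<lambda>w. ln (loc_scale p w x)) v * partial j (\<lambda>w. ln (loc_scale p w x)) v
      = ?f ((x - v $ 1) / v $ 2)"
    using AE_loc_scale[OF diff v] by eventually_elim (simp add: partial_ln_loc_scale v)
  from expect_loc_scale[OF f(1) v this] show ?thesis
    unfolding f(2) by (simp add: score_fisher_metric_def)
qed

lemma hessian_fisher_metric_nth:
  assumes p: "nonsmooth_distribution p" and inter: "interchange_condition p" and v: "v $ 2 > 0"
    and int: "has_expect p (\<lambda>y. score p i y * score p j y)"
  shows "hessian_fisher_metric p v $ i $ j = expect p (\<lambda>y. score p i y * score p j y) / (v $ 2)\<^sup>2"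
proof -
  let ?f = "\<lambda>y. score p i y / v $ 2 * (score p j y / v $ 2)"
  let ?I = "indicat_real (pos_supp (loc_scale p v))"
  have f: "has_expect p ?f" "expect p ?f = expect p (\<lambda>y. score p i y * score p j y) / (v $ 2)\<^sup>2"
    using int v by (simp_all add: has_expect_def expect_def power2_eq_square)
  have "has_expect p (\<lambda>_. 1)" "expect p (\<lambda>_. 1) = 1"
    using p by (simp_all add: has_expect_def expect_def nonsmooth_distribution_def)
  then have one: "(LINT x:pos_supp (loc_scale p w)|lebesgue. loc_scale p w x) = 1" if "w $ 2 > 0" for w
    using expect_loc_scale[of p "\<lambda>_. 1" w "\<lambda>_. 1"] that by (simp add: expect_def)
  \<comment> \<open>The total mass is 1 at every positive scale, so its first and then its second
    derivatives vanish on the half plane.\<close>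
  have "partial j (\<lambda>w. LINT x:pos_supp (loc_scale p w)|lebesgue. loc_scale p w x) w = 0"
    if "w $ 2 > 0" for w
    using that one by (rule partial_const_on_half_plane)
  with v have "partial i (partial j (\<lambda>w. LINT x:pos_supp (loc_scale p w)|lebesgue. loc_scale p w x)) v = 0"
    by (rule partial_const_on_half_plane)
  \<comment> \<open>The interchange condition moves this zero onto the integral of the second
    derivatives of the density.\<close>
  then have null: "has_bochner_integral lebesgue
     (\<lambda>x. ?I x *\<^sub>R partial i (partial j (\<lambda>w. loc_scale p w x)) v) 0"
    using inter v by (simp add: interchange_condition_def has_bochner_integral_iff set_integrable_def
        set_lebesgue_integral_def)
  have scores: "has_bochner_integral lebesgue
     (\<lambda>x. ?I x *\<^sub>R (loc_scale p v x * ?f ((x - v $ 1) / v $ 2))) (expect p ?f)"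
    by (rule has_bochner_integral_loc_scale[OF f(1) v]) simp
  \<comment> \<open>Score products minus second derivatives form the Hessian integrand almost
    everywhere on the support, so the Hessian entry equals the score entry.\<close>
  from has_bochner_integral_diff[OF scores null]
  have "has_bochner_integral lebesgue
     (\<lambda>x. ?I x *\<^sub>R (loc_scale p v x * ?f ((x - v $ 1) / v $ 2))
        - ?I x *\<^sub>R partial i (partial j (\<lambda>w. loc_scale p w x)) v) (expect p ?f)"
    by simp
  moreover have "AE y in lebesgue. y \<in> pos_supp p \<longrightarrow>
      (\<forall>\<^sub>F z in nhds y. p differentiable (at z)) \<and> deriv p differentiable (at y)"
    using inter by (simp add: interchange_condition_def)
  from AE_loc_scale[OF this v]
  have "AE x in lebesgue. ?I x *\<^sub>R (loc_scale p v x * ?f ((x - v $ 1) / v $ 2))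
        - ?I x *\<^sub>R partial i (partial j (\<lambda>w. loc_scale p w x)) v =
      ?I x *\<^sub>R (loc_scale p v x * - partial i (partial j (\<lambda>w. ln (loc_scale p w x))) v)"
  proof eventually_elim
    case (elim x)
    then show ?case
      using partial_partial_ln_loc_scale[OF v, of p x i j] v
      by (auto simp: indicator_def pos_supp_loc_scale_iff)
  qed
  ultimately have "has_bochner_integral lebesgue
     (\<lambda>x. ?I x *\<^sub>R (loc_scale p v x * - partial i (partial j (\<lambda>w. ln (loc_scale p w x))) v)) (expect p ?f)"
    by (rule has_bochner_integral_lebesgue_cong_AE)
  then show ?thesis
    unfolding f(2)
    by (simp add: hessian_fisher_metric_def expect_def set_lebesgue_integral_def has_bochner_integral_iff)
qed

text \<open>The \<open>has_expect\<close> hypotheses ensure that \<open>a2\<close> and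
  \<open>b2\<close> are genuine integrals and not the default value 0. The determinant hypothesis
  says that the metric is nondegenerate.\<close>

theorem theorem2p3:
  fixes p :: "real \<Rightarrow> real" and g :: "real^2 \<Rightarrow> real^2^2" and a2 b2 c :: real
  assumes "nonsmooth_distribution p"
    and "has_expect p (\<lambda>x. (deriv p x / p x)\<^sup>2)"
    and "has_expect p (\<lambda>x. (1 + x * (deriv p x / p x))\<^sup>2)"
    and "a2 = expect p (\<lambda>x. (deriv p x / p x)\<^sup>2)"
    and "b2 = expect p (\<lambda>x. (1 + x * (deriv p x / p x))\<^sup>2)"
    and "c = expect p (\<lambda>x. deriv p x / p x * (1 + x * (deriv p x / p x)))"
    and "a2 * b2 - c\<^sup>2 \<noteq> 0"
    and "g = score_fisher_metric p \<or> (g = hessian_fisher_metric p \<and> interchange_condition p)"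
  shows "a2 \<ge> 0 \<and> b2 \<ge> 0 \<and>
    (\<forall>l s. s > 0 \<longrightarrow>
       curvature g (vector [l, s]) = - (a2 / (a2 * b2 - c\<^sup>2)) \<and>
       (c = 0 \<and> a2 \<noteq> 0 \<longrightarrow>
          curvature g (vector [l, s]) = - (a2 / (a2 * b2)) \<and> - (a2 / (a2 * b2)) = - (1 / b2)))"
proof -
  define f where "f x = deriv p x / p x" for x
  have f: "has_expect p (\<lambda>x. (f x)\<^sup>2)" "has_expect p (\<lambda>x. (1 + x * f x)\<^sup>2)"
    and a2: "a2 = expect p (\<lambda>x. (f x)\<^sup>2)" and b2: "b2 = expect p (\<lambda>x. (1 + x * f x)\<^sup>2)"
    and c: "c = expect p (\<lambda>x. f x * (1 + x * f x))"
    using assms(2-6) by (simp_all add: f_def)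
  \<comment> \<open>Finiteness of the mixed entry \<open>c\<close> follows from that of the two
    diagonal entries.\<close>
  have "has_expect p (\<lambda>x. f x * (1 + x * f x))"
    using assms(1) f by (intro has_expect_mult_of_squares) (auto simp: nonsmooth_distribution_def)
  \<comment> \<open>Both scores carry a minus sign, which disappears in every product.\<close>
  moreover have prods: "(\<lambda>x. score p 1 x * score p 1 x) = (\<lambda>x. (f x)\<^sup>2)"
    "(\<lambda>x. score p 2 x * score p 2 x) = (\<lambda>x. (1 + x * f x)\<^sup>2)"
    "(\<lambda>x. score p 1 x * score p 2 x) = (\<lambda>x. f x * (1 + x * f x))"
    "(\<lambda>x. score p 2 x * score p 1 x) = (\<lambda>x. f x * (1 + x * f x))"
    by (auto simp: score_def f_def power2_eq_square algebra_simps)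
  ultimately have int: "has_expect p (\<lambda>x. score p i x * score p j x)" for i j
    using f exhaust_2[of i] exhaust_2[of j] by auto
  have g: "g w $ i $ j = expect p (\<lambda>y. score p i y * score p j y) / (w $ 2)\<^sup>2"
    if "w $ 2 > 0" for w i j
    using assms(1,8) that int score_fisher_metric_nth hessian_fisher_metric_nth
    by (auto simp: nonsmooth_distribution_def)
  have curv: "curvature g v = - (a2 / (a2 * b2 - c\<^sup>2))" if "v $ 2 > 0" for v
    using that assms(7) by (rule curvature_scaled_constant_metric) (simp_all add: g prods a2 b2 c)
  have "0 \<le> expect p (\<lambda>x. (h x)\<^sup>2)" for h
    using assms(1)
    by (auto simp: expect_def set_lebesgue_integral_def nonsmooth_distribution_def intro!: Bochner_Integration.integral_nonneg)
  then show ?thesis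
    using curv by (simp add: a2 b2)
qed

end
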